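(* Let $f:2^X\to\mathbb{R}_{\ge0}$ be a monotone, normalized, $(\gamma,\beta)$-weakly submodular function with $\gamma\in(0,1]$, $\beta\ge1$, let $\mathcal{M}=(X,\mathcal{I})$ be a matroid of rank $k$, and let $O\in\arg\max_{A\in\mathcal{I}}f(A)$. Then the algorithm ResidualRandomGreedy (described below) returns a set $S\in\mathcal{I}$ satisfying $$\mathbb{E}[f(S)]\ge\frac{\gamma}{\gamma+\beta}f(O).$$
   Context: $f$ is monotone if $f(A)\le f(B)$ for $A\subseteq B$, normalized if $f(\emptyset)=0$; $f(e\mid A)=f(A\cup\{e\})-f(A)$. $f$ is $(\gamma,\beta)$-weakly submodular if for all $A\subseteq B\subseteq X$: $\gamma(f(B)-f(A))\le\sum_{e\in B\setminus A}f(e\mid A)$ and $\beta(f(B)-f(A))\ge\sum_{e\in B\setminus A}f(e\mid B\setminus\{e\})$. ResidualRandomGreedy: set $S_0=\emptyset$; for $i=1,\ldots,k$, let $M_i$ be a set $T$ maximizing $\sum_{e\in T}f(e\mid S_{i-1})$ subject to $S_{i-1}\cup T$ being a base of $\mathcal{M}$ (with $T\cap S_{i-1}=\emptyset$), choose $s_i\in M_i$ uniformly at random, and set $S_i=S_{i-1}\cup\{s_i\}$; return $S=S_k$. *)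

theory Defs
  imports "HOL-Probability.Probability"
begin

locale matroid =
  fixes X :: "'a set" and \<I> :: "'a set set"
  assumes finite_ground: "finite X"
    and indep_subset_ground: "A \<in> \<I> \<Longrightarrow> A \<subseteq> X"
    and empty_indep: "{} \<in> \<I>"
    and indep_subset: "B \<in> \<I> \<Longrightarrow> A \<subseteq> B \<Longrightarrow> A \<in> \<I>"
    and augmentation: "A \<in> \<I> \<Longrightarrow> B \<in> \<I> \<Longrightarrow> card A < card B \<Longrightarrow> \<exists>e\<in>B - A. insert e A \<in> \<I>"

definition matroid_base :: "'a set set \<Rightarrow> 'a set \<Rightarrow> bool" where
  "matroid_base \<I> B \<longleftrightarrow> B \<in> \<I> \<and> (\<forall>C\<in>\<I>. B \<subseteq> C \<longrightarrow> C = B)"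

definition matroid_rank :: "'a set set \<Rightarrow> nat" where
  "matroid_rank \<I> = Max (card ` \<I>)"

definition marginal :: "('a set \<Rightarrow> real) \<Rightarrow> 'a \<Rightarrow> 'a set \<Rightarrow> real" where
  "marginal f e A = f (A \<union> {e}) - f A"

definition weakly_submodular :: "real \<Rightarrow> real \<Rightarrow> 'a set \<Rightarrow> ('a set \<Rightarrow> real) \<Rightarrow> bool" where
  "weakly_submodular \<gamma> \<beta> X f \<longleftrightarrow>
     (\<forall>A B. A \<subseteq> B \<and> B \<subseteq> X \<longrightarrow>
        \<gamma> * (f B - f A) \<le> (\<Sum>e\<in>B - A. marginal f e A) \<and>
        \<beta> * (f B - f A) \<ge> (\<Sum>e\<in>B - A. marginal f e (B - {e})))"

definition greedy_completion ::
    "('a set \<Rightarrow> real) \<Rightarrow> 'a set set \<Rightarrow> 'a set \<Rightarrow> 'a set \<Rightarrow> bool" where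
  "greedy_completion f \<I> S T \<longleftrightarrow>
     is_arg_max (\<lambda>T. \<Sum>e\<in>T. marginal f e S) (\<lambda>T. T \<inter> S = {} \<and> matroid_base \<I> (S \<union> T)) T"

text \<open>
  The maximizer in an iteration need not be unique. A selection rule \<open>M\<close> resolves the ties: it maps
  the list \<open>[s\<^sub>1, \<dots>, s\<^sub>i]\<close> of elements picked so far to the set from which the next element is drawn,
  so the choice may depend on the whole history of the run and not only on the current set.
\<close>

definition greedy_rule ::
    "('a set \<Rightarrow> real) \<Rightarrow> 'a set set \<Rightarrow> ('a list \<Rightarrow> 'a set) \<Rightarrow> bool" where
  "greedy_rule f \<I> M \<longleftrightarrow> (\<forall>h. set h \<in> \<I> \<longrightarrow> greedy_completion f \<I> (set h) (M h))"

primrec greedy_picks :: "('a list \<Rightarrow> 'a set) \<Rightarrow> nat \<Rightarrow> 'a list pmf" where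
  "greedy_picks M 0 = return_pmf []"
| "greedy_picks M (Suc i) =
     bind_pmf (greedy_picks M i) (\<lambda>h.
     bind_pmf (pmf_of_set (M h)) (\<lambda>s.
     return_pmf (h @ [s])))"

definition residual_random_greedy :: "('a list \<Rightarrow> 'a set) \<Rightarrow> nat \<Rightarrow> 'a set pmf" where
  "residual_random_greedy M k = map_pmf set (greedy_picks M k)"

end

theory Submission
  imports Defs
begin

text \<open>
  Along a run, keep a base \<open>B\<close> containing the current set \<open>S\<close>, starting from a base containing the
  optimum. If \<open>T\<close> is the greedy completion of \<open>S\<close>, Brualdi's exchange theorem gives a bijection
  \<open>g\<close> from \<open>T\<close> to \<open>B - S\<close> such that \<open>B - {g s} \<union> {s}\<close> is a base for every \<open>s\<close> in \<open>T\<close>; when \<open>s\<close> is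
  picked, \<open>B\<close> is replaced by that base. By maximality of \<open>T\<close> and the lower weak submodularity bound,
  \<open>f S\<close> gains at least \<open>\<gamma> (f B - f S) / |T|\<close> on average; by monotonicity and the upper bound, \<open>f B\<close>
  loses at most \<open>\<beta> (f B - f S) / |T|\<close> on average. Hence \<open>\<beta> f S + \<gamma> f B\<close> does not decrease in
  expectation. At the start it is at least \<open>\<gamma>\<close> times the optimum, and at the end \<open>B = S\<close>.
\<close>

section \<open>Exchange between bases of a matroid\<close>

lemma card_insert_Diff_singleton:
  assumes "finite B" "x \<in> B" "y \<notin> B"
  shows "card (insert y (B - {x})) = card B"
proof -
  have "card (insert y (B - {x})) = Suc (card (B - {x}))" using assms by simp
  then show ?thesis using assms(1,2) by (simp only: card_Suc_Diff1)
qed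

context matroid
begin

lemma finite_indep: "A \<in> \<I> \<Longrightarrow> finite A"
  using finite_ground finite_subset indep_subset_ground by blast

lemma finite_indep_sets: "finite \<I>"
  using finite_ground indep_subset_ground by (meson Pow_iff finite_Pow_iff finite_subset subsetI)

lemma card_indep_le_rank: "A \<in> \<I> \<Longrightarrow> card A \<le> matroid_rank \<I>"
  unfolding matroid_rank_def using finite_indep_sets by simp

lemma exists_indep_card_rank: "\<exists>A\<in>\<I>. card A = matroid_rank \<I>"
proof -
  have "matroid_rank \<I> \<in> card ` \<I>"
    unfolding matroid_rank_def using finite_indep_sets empty_indep by (intro Max_in) auto
  then show ?thesis by auto
qed

text \<open>Augmentation is iterated until the sizes agree. Keeping \<open>D\<close> inside
  \<open>A \<union> B\<close> records where the added elements come from, which the exchange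
  argument relies on.\<close>

lemma extend_indep:
  assumes "A \<in> \<I>" "B \<in> \<I>" "card A \<le> card B"
  shows "\<exists>D\<in>\<I>. A \<subseteq> D \<and> D \<subseteq> A \<union> B \<and> card D = card B"
  using assms
proof (induction "card B - card A" arbitrary: A)
  case 0
  then show ?case by (intro bexI[of _ A]) auto
next
  case (Suc n)
  then obtain e where e: "e \<in> B - A" "insert e A \<in> \<I>"
    using augmentation[of A B] by (metis zero_less_Suc zero_less_diff)
  have c: "card (insert e A) = Suc (card A)"
    using e Suc.prems finite_indep by simp
  obtain D where "D \<in> \<I>" "insert e A \<subseteq> D" "D \<subseteq> insert e A \<union> B" "card D = card B"
    using Suc.hyps(1)[OF _ e(2) Suc.prems(2)] Suc.hyps(2) c by force
  then show ?case using e by (intro bexI[of _ D]) auto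
qed

text \<open>Every independent set extends to rank size, so inclusion-maximal sets already have
  maximal cardinality. Bases can then be recognised by counting.\<close>

lemma matroid_base_iff: "matroid_base \<I> B \<longleftrightarrow> B \<in> \<I> \<and> card B = matroid_rank \<I>"
proof
  assume B: "matroid_base \<I> B"
  obtain A where A: "A \<in> \<I>" "card A = matroid_rank \<I>" using exists_indep_card_rank by blast
  have "B \<in> \<I>" using B by (simp add: matroid_base_def)
  moreover obtain D where "D \<in> \<I>" "B \<subseteq> D" "card D = card A"
    using extend_indep[of B A] A \<open>B \<in> \<I>\<close> card_indep_le_rank by auto
  ultimately show "B \<in> \<I> \<and> card B = matroid_rank \<I>"
    using B A by (auto simp: matroid_base_def)
next
  assume B: "B \<in> \<I> \<and> card B = matroid_rank \<I>"
  then show "matroid_base \<I> B"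
    unfolding matroid_base_def
    using card_indep_le_rank finite_indep by (metis card_seteq)
qed

lemma indep_subset_base:
  assumes "A \<in> \<I>"
  obtains B where "A \<subseteq> B" "matroid_base \<I> B"
  using exists_indep_card_rank extend_indep[OF assms] card_indep_le_rank[OF assms]
  by (metis matroid_base_iff)

text \<open>The same \<open>x\<close> must serve both exchanges. It is taken from the circuit that
  \<open>y\<close> closes in \<open>B1\<close>, apart from \<open>y\<close>: removing any such
  element from \<open>insert y B1\<close> leaves a base, and not all of them lie in the span of
  \<open>B2 - {y}\<close>, as \<open>y\<close> would then lie there too.\<close>

lemma symmetric_exchange:
  assumes B1: "matroid_base \<I> B1" and B2: "matroid_base \<I> B2" and y: "y \<in> B2 - B1"
  obtains x where "x \<in> B1 - B2" "matroid_base \<I> (insert y (B1 - {x}))"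
    "matroid_base \<I> (insert x (B2 - {y}))"
proof -
  let ?r = "matroid_rank \<I>"
  have I: "B1 \<in> \<I>" "B2 \<in> \<I>" "card B1 = ?r" "card B2 = ?r"
    using B1 B2 by (auto simp: matroid_base_iff)
  note fin = finite_indep[OF I(1)] finite_indep[OF I(2)]
  have "insert y B1 \<notin> \<I>" using B1 y unfolding matroid_base_def by blast
  \<comment> \<open>\<open>C \<union> {y}\<close> is the fundamental circuit of \<open>y\<close> with respect to \<open>B1\<close>.\<close>
  then obtain C where C: "C \<subseteq> B1" "insert y C \<notin> \<I>"
    and C_min: "\<And>C'. C' \<subset> C \<Longrightarrow> insert y C' \<in> \<I>"
  proof -
    let ?P = "\<lambda>C. C \<subseteq> B1 \<and> insert y C \<notin> \<I>"
    have "?P B1" using \<open>insert y B1 \<notin> \<I>\<close> by simp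
    then obtain C where C: "?P C" "\<And>C'. ?P C' \<Longrightarrow> card C \<le> card C'"
      using ex_has_least_nat[of ?P B1 card] by blast
    show ?thesis
    proof (rule that)
      fix C' assume "C' \<subset> C"
      then have "card C' < card C" using C fin by (meson finite_subset psubset_card_mono)
      then show "insert y C' \<in> \<I>" using C \<open>C' \<subset> C\<close> by (meson leD order_trans psubset_imp_subset)
    qed (use C in auto)
  qed
  have C_indep: "C \<in> \<I>" using I(1) C(1) by (rule indep_subset)
  have "\<exists>x\<in>C - (B2 - {y}). insert x (B2 - {y}) \<in> \<I>"
  proof -
    \<comment> \<open>\<open>D\<close> completes \<open>C\<close> to rank size and misses
      \<open>y\<close>, as \<open>insert y C\<close> is dependent. Being larger than
      \<open>B2 - {y}\<close>, it augments that set, and does so by an element of \<open>C\<close>,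
      since the rest of \<open>D\<close> lies in \<open>B2 - {y}\<close>.\<close>
    obtain D where D: "D \<in> \<I>" "C \<subseteq> D" "D \<subseteq> C \<union> B2" "card D = ?r"
      using extend_indep[OF C_indep I(2)] card_indep_le_rank[OF C_indep] I(4) by auto
    have "y \<notin> D" using C(2) D(1,2) indep_subset by (metis insert_subset)
    have "B2 - {y} \<in> \<I>" by (rule indep_subset[OF I(2)]) auto
    moreover have "card (B2 - {y}) < card D"
      using D(4) I(4) y fin by (metis DiffD1 card_Diff1_less)
    ultimately obtain x where "x \<in> D - (B2 - {y})" "insert x (B2 - {y}) \<in> \<I>"
      using augmentation[OF _ D(1)] by blast
    then show ?thesis using D(3) \<open>y \<notin> D\<close> by blast
  qed
  then obtain x where x: "x \<in> C" "x \<notin> B2 - {y}" "insert x (B2 - {y}) \<in> \<I>" by blast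
  have x': "x \<in> B1 - B2" using x C(1) y by blast
  have "matroid_base \<I> (insert y (B1 - {x}))"
  proof -
    \<comment> \<open>By minimality of \<open>C\<close>, dropping \<open>x\<close> makes room for
      \<open>y\<close>. The extension \<open>D\<close> omits \<open>x\<close>, or it would contain
      the dependent set \<open>insert y C\<close>; counting then identifies
      \<open>D\<close>.\<close>
    have i: "insert y (C - {x}) \<in> \<I>" using C_min[of "C - {x}"] x(1) by blast
    obtain D where D: "D \<in> \<I>" "insert y (C - {x}) \<subseteq> D" "D \<subseteq> insert y (C - {x}) \<union> B1"
      "card D = ?r"
      using extend_indep[OF i I(1)] card_indep_le_rank[OF i] I(3) by auto
    have "x \<notin> D"
    proof
      assume "x \<in> D"
      then have "insert y C \<subseteq> D" using D(2) by blast
      then show False using C(2) indep_subset[OF D(1)] by simp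
    qed
    then have "D \<subseteq> insert y (B1 - {x})" using D(3) C(1) by blast
    moreover have "card (insert y (B1 - {x})) = ?r"
      using card_insert_Diff_singleton[of B1 x y] I(3) x' y fin by simp
    ultimately have "D = insert y (B1 - {x})" using D(4) fin by (intro card_subset_eq) auto
    then show ?thesis using D by (simp add: matroid_base_iff)
  qed
  moreover have "matroid_base \<I> (insert x (B2 - {y}))"
    using card_insert_Diff_singleton[of B2 y x] x(3) x' I(4) y fin by (simp add: matroid_base_iff)
  ultimately show thesis using that x' by blast
qed

text \<open>A symmetric exchange pairs \<open>x\<close> with \<open>y\<close> and moves
  \<open>B1\<close> one step towards \<open>B2\<close>. Since every required exchange is performed
  in the same fixed \<open>B2\<close>, the pairs found for the new \<open>B1\<close> stay
  valid.\<close>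

lemma base_exchange_bij_diff:
  assumes "matroid_base \<I> B1" "matroid_base \<I> B2"
  shows "\<exists>g. bij_betw g (B1 - B2) (B2 - B1) \<and>
    (\<forall>s\<in>B1 - B2. matroid_base \<I> (insert s (B2 - {g s})))"
  using assms(1)
proof (induction "card (B2 - B1)" arbitrary: B1)
  case 0
  \<comment> \<open>Finiteness is what turns \<open>card (B2 - B1) = 0\<close> into an inclusion,
    since \<open>card\<close> is also 0 on infinite sets.\<close>
  have "finite B2" using assms(2) finite_indep matroid_base_iff by blast
  then have "B2 \<subseteq> B1" using 0 by simp
  then have "B1 = B2" using 0 assms(2) unfolding matroid_base_def by blast
  then show ?case by (simp add: bij_betw_def)
next
  case (Suc n)
  then obtain y where y: "y \<in> B2 - B1" by (metis card.empty ex_in_conv nat.distinct(1))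
  obtain x where x: "x \<in> B1 - B2" "matroid_base \<I> (insert y (B1 - {x}))"
    "matroid_base \<I> (insert x (B2 - {y}))"
    using symmetric_exchange[OF Suc.prems assms(2) y] by blast
  let ?B = "insert y (B1 - {x})"
  have e: "?B - B2 = B1 - B2 - {x}" "B2 - ?B = B2 - B1 - {y}" using x(1) y by auto
  have "n = card (B2 - ?B)" using Suc.hyps(2) y e by (simp add: card_Diff_singleton)
  then obtain g where g: "bij_betw g (B1 - B2 - {x}) (B2 - B1 - {y})"
    "\<forall>s\<in>B1 - B2 - {x}. matroid_base \<I> (insert s (B2 - {g s}))"
    using Suc.hyps(1)[OF _ x(2)] e by auto
  let ?h = "g(x := y)"
  have "bij_betw ?h (B1 - B2 - {x}) (B2 - B1 - {y})"
    using g(1) by (subst bij_betw_cong[of _ _ g]) auto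
  then have "bij_betw ?h (insert x (B1 - B2 - {x})) (insert y (B2 - B1 - {y}))"
    using notIn_Un_bij_betw[of x "B1 - B2 - {x}" ?h "B2 - B1 - {y}"] by simp
  then have "bij_betw ?h (B1 - B2) (B2 - B1)" using x(1) y by (simp add: insert_absorb)
  moreover have "\<forall>s\<in>B1 - B2. matroid_base \<I> (insert s (B2 - {?h s}))" using g(2) x(3) by auto
  ultimately show ?case by blast
qed

text \<open>Common elements outside \<open>S\<close> are matched to themselves; exchanging such an
  element for itself leaves \<open>B2\<close> unchanged.\<close>

lemma base_exchange_bij:
  assumes "matroid_base \<I> B1" "matroid_base \<I> B2" "S \<subseteq> B1" "S \<subseteq> B2"
  obtains g where "bij_betw g (B1 - S) (B2 - S)"
    "\<And>s. s \<in> B1 - S \<Longrightarrow> matroid_base \<I> (insert s (B2 - {g s}))"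
proof -
  obtain g where g: "bij_betw g (B1 - B2) (B2 - B1)"
    "\<forall>s\<in>B1 - B2. matroid_base \<I> (insert s (B2 - {g s}))"
    using base_exchange_bij_diff assms by blast
  let ?h = "\<lambda>s. if s \<in> B2 then s else g s"
  have "bij_betw ?h (B1 - B2) (B2 - B1)"
    using g(1) by (subst bij_betw_cong[of _ _ g]) auto
  moreover have "bij_betw ?h (B1 \<inter> B2 - S) (B1 \<inter> B2 - S)"
    by (subst bij_betw_cong[of _ _ id]) auto
  ultimately have "bij_betw ?h ((B1 - B2) \<union> (B1 \<inter> B2 - S)) ((B2 - B1) \<union> (B1 \<inter> B2 - S))"
    by (rule bij_betw_combine) auto
  moreover have "(B1 - B2) \<union> (B1 \<inter> B2 - S) = B1 - S" "(B2 - B1) \<union> (B1 \<inter> B2 - S) = B2 - S"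
    using assms by auto
  ultimately have "bij_betw ?h (B1 - S) (B2 - S)" by simp
  moreover have "matroid_base \<I> (insert s (B2 - {?h s}))" if "s \<in> B1 - S" for s
    using that g(2) assms(2) by (auto simp: insert_absorb)
  ultimately show thesis using that by blast
qed

end

section \<open>The expected potential along a run\<close>

text \<open>Continuation of a run from the history \<open>h\<close>, unfolded at the first pick,
  whereas \<open>greedy_picks\<close> unfolds at the last. Induction on the remaining picks can then
  let the history and the accompanying base vary.\<close>

primrec greedy_picks_from :: "('a list \<Rightarrow> 'a set) \<Rightarrow> 'a list \<Rightarrow> nat \<Rightarrow> 'a list pmf" where
  "greedy_picks_from M h 0 = return_pmf h"
| "greedy_picks_from M h (Suc n) =
     bind_pmf (pmf_of_set (M h)) (\<lambda>s. greedy_picks_from M (h @ [s]) n)"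

lemma greedy_picks_add:
  "greedy_picks M (i + n) = bind_pmf (greedy_picks M i) (\<lambda>h. greedy_picks_from M h n)"
proof (induction n arbitrary: i)
  case 0
  then show ?case by (simp add: bind_return_pmf')
next
  case (Suc n)
  have "greedy_picks M (i + Suc n) = greedy_picks M (Suc i + n)" by simp
  also have "\<dots> = bind_pmf (greedy_picks M (Suc i)) (\<lambda>h. greedy_picks_from M h n)"
    by (rule Suc.IH)
  finally show ?case by (simp add: bind_assoc_pmf bind_return_pmf)
qed

lemma greedy_picks_eq_from_Nil: "greedy_picks M k = greedy_picks_from M [] k"
  using greedy_picks_add[of M 0 k] by (simp add: bind_return_pmf)

locale greedy_run = matroid X \<I>
  for X :: "'a set" and \<I> +
  fixes f :: "'a set \<Rightarrow> real" and \<gamma> \<beta> :: real and M :: "'a list \<Rightarrow> 'a set"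
  assumes f_mono: "mono_on (Pow X) f"
    and gamma_nonneg: "0 \<le> \<gamma>" and beta_nonneg: "0 \<le> \<beta>"
    and f_weakly_submodular: "weakly_submodular \<gamma> \<beta> X f"
    and M_greedy: "greedy_rule f \<I> M"
begin

lemma completion:
  assumes "set h \<in> \<I>"
  shows "M h \<inter> set h = {}" "matroid_base \<I> (set h \<union> M h)"
    "\<And>T. T \<inter> set h = {} \<Longrightarrow> matroid_base \<I> (set h \<union> T) \<Longrightarrow>
      (\<Sum>e\<in>T. marginal f e (set h)) \<le> (\<Sum>e\<in>M h. marginal f e (set h))"
proof -
  have "greedy_completion f \<I> (set h) (M h)" using M_greedy assms by (simp add: greedy_rule_def)
  then show "M h \<inter> set h = {}" "matroid_base \<I> (set h \<union> M h)"
    "\<And>T. T \<inter> set h = {} \<Longrightarrow> matroid_base \<I> (set h \<union> T) \<Longrightarrow>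
      (\<Sum>e\<in>T. marginal f e (set h)) \<le> (\<Sum>e\<in>M h. marginal f e (set h))"
    by (simp_all add: greedy_completion_def is_arg_max_linorder)
qed

lemma finite_completion: "set h \<in> \<I> \<Longrightarrow> finite (M h)"
  using completion(2)[of h] finite_indep[of "set h \<union> M h"] by (simp add: matroid_base_def)

lemma card_completion:
  assumes "set h \<in> \<I>"
  shows "card (set h) + card (M h) = matroid_rank \<I>"
  using completion(1,2)[OF assms] finite_completion[OF assms] card_Un_disjoint[of "set h" "M h"]
  by (simp add: matroid_base_iff Int_commute)

lemma insert_pick:
  assumes "set h \<in> \<I>" "s \<in> M h"
  shows "insert s (set h) \<in> \<I>" "card (insert s (set h)) = Suc (card (set h))"
proof -
  show "insert s (set h) \<in> \<I>"
    by (rule indep_subset[of "set h \<union> M h"])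
      (use completion(2)[OF assms(1)] assms(2) in \<open>auto simp: matroid_base_def\<close>)
  show "card (insert s (set h)) = Suc (card (set h))"
    using completion(1)[OF assms(1)] assms(2) by (intro card_insert_disjoint) auto
qed

lemma completion_nonempty:
  assumes "set h \<in> \<I>" "card (set h) < matroid_rank \<I>"
  shows "M h \<noteq> {}"
  using card_completion[OF assms(1)] assms(2) by auto

text \<open>The size assumption keeps the current set below full rank before each pick, so
  \<open>M h\<close> is nonempty and \<open>pmf_of_set\<close> is genuinely uniform. Finite supports
  allow expectations to be split over the first pick.\<close>

lemma set_greedy_picks_from:
  assumes "set h \<in> \<I>" "card (set h) + n = matroid_rank \<I>"
  shows "set_pmf (greedy_picks_from M h n) \<subseteq> {h. set h \<in> \<I>}"
    and "finite (set_pmf (greedy_picks_from M h n))"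
  using assms
proof (induction n arbitrary: h)
  case (Suc n)
  {
    case 1
    have "set_pmf (greedy_picks_from M (h @ [s]) n) \<subseteq> {h. set h \<in> \<I>}" if "s \<in> M h" for s
      using Suc.IH(1)[of "h @ [s]"] insert_pick[OF 1(1) that] 1(2) by simp
    then show ?case
      using completion_nonempty[of h] finite_completion[of h] 1 by (simp add: UN_subset_iff)
  next
    case 2
    have "finite (set_pmf (greedy_picks_from M (h @ [s]) n))" if "s \<in> M h" for s
      using Suc.IH(2)[of "h @ [s]"] insert_pick[OF 2(1) that] 2(2) by simp
    then show ?case
      using completion_nonempty[of h] finite_completion[of h] 2 by simp
  }
qed auto

text \<open>Total gain and total loss are both bounded through \<open>f B - f (set h)\<close>. The
  weights \<beta> and \<gamma> turn the two bounds into
  \<open>\<gamma> * \<beta> * (f B - f (set h))\<close> with opposite signs, which cancel.\<close>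

lemma potential_step:
  assumes S: "set h \<in> \<I>" "set h \<subseteq> B" "matroid_base \<I> B"
    and g: "bij_betw g (M h) (B - set h)"
      "\<And>s. s \<in> M h \<Longrightarrow> matroid_base \<I> (insert s (B - {g s}))"
  shows "real (card (M h)) * (\<beta> * f (set h) + \<gamma> * f B) \<le>
    (\<Sum>s\<in>M h. \<beta> * f (insert s (set h)) + \<gamma> * f (insert s (B - {g s})))"
proof -
  let ?S = "set h"
  let ?c = "real (card (M h))"
  have BX: "B \<subseteq> X" using S(3) indep_subset_ground matroid_base_iff by blast
  have card_eq: "card (M h) = card (B - ?S)" using g(1) by (rule bij_betw_same_card)
  have gain: "\<gamma> * (f B - f ?S) \<le> (\<Sum>s\<in>M h. marginal f s ?S)"
  proof -
    have "\<gamma> * (f B - f ?S) \<le> (\<Sum>s\<in>B - ?S. marginal f s ?S)"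
      using f_weakly_submodular S(2) BX by (simp add: weakly_submodular_def)
    \<comment> \<open>\<open>B - set h\<close> is itself an admissible completion, so it competes
      with \<open>M h\<close>.\<close>
    also have "\<dots> \<le> (\<Sum>s\<in>M h. marginal f s ?S)"
      using S by (intro completion(3)) (auto simp: Un_absorb1)
    finally show ?thesis .
  qed
  have loss: "?c * f B - \<beta> * (f B - f ?S) \<le> (\<Sum>s\<in>M h. f (insert s (B - {g s})))"
  proof -
    have "(\<Sum>e\<in>B - ?S. marginal f e (B - {e})) = (\<Sum>e\<in>B - ?S. f B - f (B - {e}))"
      by (intro sum.cong) (auto simp: marginal_def insert_absorb)
    \<comment> \<open>The upper weak submodularity bound between \<open>set h\<close> and
      \<open>B\<close> limits the total cost of the single-element deletions.\<close>
    then have "(\<Sum>e\<in>B - ?S. f B - f (B - {e})) \<le> \<beta> * (f B - f ?S)"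
      using f_weakly_submodular S(2) BX unfolding weakly_submodular_def by metis
    then have "?c * f B - \<beta> * (f B - f ?S) \<le> (\<Sum>e\<in>B - ?S. f (B - {e}))"
      by (simp add: sum_subtractf card_eq)
    \<comment> \<open>As \<open>g\<close> is a bijection, each element of \<open>B - set h\<close>
      is deleted for exactly one pick.\<close>
    also have "\<dots> = (\<Sum>s\<in>M h. f (B - {g s}))"
      using g(1) by (rule sum.reindex_bij_betw[symmetric])
    \<comment> \<open>Inserting \<open>s\<close> cannot lower the value, by monotonicity inside
      \<open>X\<close>.\<close>
    also have "\<dots> \<le> (\<Sum>s\<in>M h. f (insert s (B - {g s})))"
    proof (intro sum_mono mono_onD[OF f_mono])
      fix s assume "s \<in> M h"
      then show "insert s (B - {g s}) \<in> Pow X"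
        using g(2) indep_subset_ground matroid_base_iff by blast
    qed (use BX in auto)
    finally show ?thesis .
  qed
  have "(\<Sum>s\<in>M h. \<beta> * f (insert s ?S) + \<gamma> * f (insert s (B - {g s}))) =
    \<beta> * (?c * f ?S + (\<Sum>s\<in>M h. marginal f s ?S)) + \<gamma> * (\<Sum>s\<in>M h. f (insert s (B - {g s})))"
    by (simp add: sum.distrib sum_distrib_left[symmetric] marginal_def sum_subtractf)
  also have "\<dots> \<ge> \<beta> * (?c * f ?S + \<gamma> * (f B - f ?S)) + \<gamma> * (?c * f B - \<beta> * (f B - f ?S))"
    using gain loss gamma_nonneg beta_nonneg by (intro add_mono mult_left_mono) auto
  also have "\<beta> * (?c * f ?S + \<gamma> * (f B - f ?S)) + \<gamma> * (?c * f B - \<beta> * (f B - f ?S)) =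
    ?c * (\<beta> * f ?S + \<gamma> * f B)"
    by (simp add: algebra_simps)
  finally show ?thesis .
qed

text \<open>The one-step bound is averaged over the first pick. The induction ranges over all bases
  because \<open>B\<close> changes with the pick. At the end the base equals the current set, so the
  two weights merge into the factor \<open>\<gamma> + \<beta>\<close>.\<close>

lemma expectation_ge_potential:
  assumes "set h \<in> \<I>" "card (set h) + n = matroid_rank \<I>" "set h \<subseteq> B" "matroid_base \<I> B"
  shows "\<beta> * f (set h) + \<gamma> * f B \<le>
    (\<gamma> + \<beta>) * measure_pmf.expectation (greedy_picks_from M h n) (\<lambda>h. f (set h))"
  using assms
proof (induction n arbitrary: h B)
  case 0
  \<comment> \<open>With no picks left the current set has rank size, so it fills the base
    containing it.\<close>
  have "B = set h"
    using 0 finite_indep unfolding matroid_base_iff by (metis add.right_neutral card_subset_eq)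
  then show ?case by (simp add: algebra_simps)
next
  case (Suc n)
  let ?S = "set h"
  let ?E = "\<lambda>s. measure_pmf.expectation (greedy_picks_from M (h @ [s]) n) (\<lambda>h. f (set h))"
  let ?c = "real (card (M h))"
  note compl = completion[OF Suc.prems(1)]
  have fin: "finite (M h)" "M h \<noteq> {}"
    using finite_completion completion_nonempty Suc.prems by auto
  have cpos: "?c > 0" using fin by (simp add: card_gt_0_iff)
  have diff: "?S \<union> M h - ?S = M h" using compl(1) by blast
  obtain g where g: "bij_betw g (M h) (B - ?S)"
    "\<And>s. s \<in> M h \<Longrightarrow> matroid_base \<I> (insert s (B - {g s}))"
    using base_exchange_bij[OF compl(2) Suc.prems(4) _ Suc.prems(3)] unfolding diff by blast
  have step: "\<beta> * f (insert s ?S) + \<gamma> * f (insert s (B - {g s})) \<le> (\<gamma> + \<beta>) * ?E s"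
    if s: "s \<in> M h" for s
  proof -
    \<comment> \<open>Only an element outside the current set is deleted, so the new base still
      contains that set together with \<open>s\<close>.\<close>
    have "g s \<in> B - ?S" using g(1) s by (rule bij_betwE[rule_format])
    then have "set (h @ [s]) \<subseteq> insert s (B - {g s})" using Suc.prems(3) by auto
    then show ?thesis
      using Suc.IH[of "h @ [s]" "insert s (B - {g s})"] insert_pick[OF Suc.prems(1) s]
        Suc.prems(2) g(2)[OF s] by simp
  qed
  have "?c * (\<beta> * f ?S + \<gamma> * f B) \<le> (\<Sum>s\<in>M h. (\<gamma> + \<beta>) * ?E s)"
    using potential_step[OF Suc.prems(1,3,4) g] sum_mono[OF step] by (rule order_trans)
  then have "\<beta> * f ?S + \<gamma> * f B \<le> (\<gamma> + \<beta>) * ((\<Sum>s\<in>M h. ?E s) / ?c)"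
    using cpos by (simp add: sum_distrib_left[symmetric] pos_le_divide_eq mult.commute)
  \<comment> \<open>Conditioning on the uniform first pick makes the expectation an average; the
    finite supports justify the split.\<close>
  also have "(\<Sum>s\<in>M h. ?E s) / ?c =
    measure_pmf.expectation (greedy_picks_from M h (Suc n)) (\<lambda>h. f (set h))"
  proof -
    have "finite (set_pmf (greedy_picks_from M (h @ [s]) n))" if "s \<in> M h" for s
      using set_greedy_picks_from(2)[of "h @ [s]" n] insert_pick[OF Suc.prems(1) that] Suc.prems(2)
      by simp
    then show ?thesis
      using fin by (simp add: pmf_expectation_bind_pmf_of_set sum_divide_distrib field_simps)
  qed
  finally show ?case .
qed

end

theorem theorem2:
  fixes f :: "'a set \<Rightarrow> real" and X :: "'a set" and \<I> :: "'a set set"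
    and \<gamma> \<beta> :: real and k :: nat and Opt :: "'a set" and M :: "'a list \<Rightarrow> 'a set"
  assumes "matroid X \<I>"
    and "matroid_rank \<I> = k"
    and "\<And>A. A \<subseteq> X \<Longrightarrow> 0 \<le> f A"
    and "mono_on (Pow X) f"
    and "f {} = 0"
    and "0 < \<gamma>" and "\<gamma> \<le> 1" and "1 \<le> \<beta>"
    and "weakly_submodular \<gamma> \<beta> X f"
    and "is_arg_max f (\<lambda>A. A \<in> \<I>) Opt"
    and "greedy_rule f \<I> M"
  shows "set_pmf (residual_random_greedy M k) \<subseteq> \<I> \<and>
         measure_pmf.expectation (residual_random_greedy M k) f \<ge> \<gamma> / (\<gamma> + \<beta>) * f Opt"
proof -
  interpret matroid X \<I> by fact
  interpret greedy_run X \<I> f \<gamma> \<beta> M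
    using assms by unfold_locales auto
  have "Opt \<in> \<I>" using assms(10) by (simp add: is_arg_max_def)
  then obtain B where B: "Opt \<subseteq> B" "matroid_base \<I> B" by (rule indep_subset_base)
  have "B \<subseteq> X" using B(2) indep_subset_ground matroid_base_iff by blast
  let ?E = "measure_pmf.expectation (greedy_picks_from M [] k) (\<lambda>h. f (set h))"
  \<comment> \<open>Enlarging the optimum to a base cannot lower its value.\<close>
  have "\<gamma> * f Opt \<le> \<gamma> * f B"
    using B(1) \<open>B \<subseteq> X\<close> assms(4,6) by (auto intro!: mult_left_mono mono_onD[of "Pow X" f])
  \<comment> \<open>At the empty history \<open>f {} = 0\<close>, so the potential reduces to
    \<open>\<gamma> * f B\<close>.\<close>
  also have "\<dots> \<le> (\<gamma> + \<beta>) * ?E"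
    using expectation_ge_potential[of "[]" k B] B(2) assms(2,5) empty_indep by simp
  finally have "\<gamma> / (\<gamma> + \<beta>) * f Opt \<le> ?E"
    using assms(6,8) by (simp add: field_simps)
  moreover have "set_pmf (residual_random_greedy M k) \<subseteq> \<I>"
    using set_greedy_picks_from(1)[of "[]" k] assms(2) empty_indep
    by (auto simp: residual_random_greedy_def greedy_picks_eq_from_Nil)
  ultimately show ?thesis
    by (simp add: residual_random_greedy_def greedy_picks_eq_from_Nil)
qed

end
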